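(* Let $\alpha\ge0$, $0\le\beta<1$, and $f=h+\overline{g}\in\mathcal{W}_{\mathcal{H}}^0(\alpha,\beta)$. If the integers $p,q\ge1$ satisfy one of (i) $1=p<q$, (ii) $3\le p<q$, (iii) $3\le q<p$, then the partial sum $s_{p,q}(f)$ is a convex harmonic mapping in the disk $|z|<1/4$ (i.e. it is univalent there and maps $\{|z|<1/4\}$ onto a convex domain).
   Context: Let $\mathbb{D}=\{z\in\mathbb{C}:|z|<1\}$. $\mathcal{H}^0$ denotes the class of harmonic maps $f=h+\overline{g}$ on $\mathbb{D}$, with $h,g$ analytic in $\mathbb{D}$, $h(z)=z+\sum_{n\ge2}a_nz^n$ and $g(z)=\sum_{n\ge2}b_nz^n$. For $\alpha\ge0$, $0\le\beta<1$, $\mathcal{W}_{\mathcal{H}}^0(\alpha,\beta)$ denotes the class of $f=h+\overline{g}\in\mathcal{H}^0$ such that $\Re\big(h'(z)+\alpha zh''(z)-\beta\big)>|g'(z)+\alpha zg''(z)|$ for all $z\in\mathbb{D}$. For such $f$ and integers $p,q\ge1$, the $(p,q)$-th partial sum is $s_{p,q}(f)=s_p(h)+\overline{s_q(g)}$, where $s_p(h)(z)=z+\sum_{k=2}^pa_kz^k$ and $s_q(g)(z)=\sum_{k=2}^qb_kz^k$ (empty sums are $0$). *)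

theory Defs
  imports "HOL-Complex_Analysis.Complex_Analysis"
begin

abbreviation unit_disk :: "complex set" where
  "unit_disk \<equiv> ball 0 1"

definition tcoeff :: "(complex \<Rightarrow> complex) \<Rightarrow> nat \<Rightarrow> complex" where
  "tcoeff F n = (deriv ^^ n) F 0 / of_nat (fact n)"

definition in_H0 :: "(complex \<Rightarrow> complex) \<Rightarrow> (complex \<Rightarrow> complex) \<Rightarrow> bool" where
  "in_H0 h g \<longleftrightarrow> h holomorphic_on unit_disk \<and> g holomorphic_on unit_disk \<and>
     h 0 = 0 \<and> deriv h 0 = 1 \<and> g 0 = 0 \<and> deriv g 0 = 0"

definition W_H0 :: "real \<Rightarrow> real \<Rightarrow> (complex \<Rightarrow> complex) \<Rightarrow> (complex \<Rightarrow> complex) \<Rightarrow> bool" where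
  "W_H0 \<alpha> \<beta> h g \<longleftrightarrow> in_H0 h g \<and>
     (\<forall>z\<in>unit_disk. Re (deriv h z + of_real \<alpha> * z * (deriv ^^ 2) h z - of_real \<beta>)
                     > cmod (deriv g z + of_real \<alpha> * z * (deriv ^^ 2) g z))"

definition psum_h :: "(complex \<Rightarrow> complex) \<Rightarrow> nat \<Rightarrow> complex \<Rightarrow> complex" where
  "psum_h h p z = z + (\<Sum>k=2..p. tcoeff h k * z ^ k)"

definition psum_g :: "(complex \<Rightarrow> complex) \<Rightarrow> nat \<Rightarrow> complex \<Rightarrow> complex" where
  "psum_g g q z = (\<Sum>k=2..q. tcoeff g k * z ^ k)"

definition psum_pq :: "(complex \<Rightarrow> complex) \<Rightarrow> (complex \<Rightarrow> complex) \<Rightarrow> nat \<Rightarrow> nat \<Rightarrow> complex \<Rightarrow> complex" where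
  "psum_pq h g p q z = psum_h h p z + cnj (psum_g g q z)"

definition convex_map_on :: "(complex \<Rightarrow> complex) \<Rightarrow> complex set \<Rightarrow> bool" where
  "convex_map_on F S \<longleftrightarrow> inj_on F S \<and> convex (F ` S)"

end

theory Submission
  imports Defs
begin

text \<open>
  Write \<open>\<phi> = s\<^sub>p(h)\<close>, \<open>\<psi> = s\<^sub>q(g)\<close> and \<open>G = \<phi> + \<epsilon>\<psi>\<close> with \<open>|\<epsilon>| = 1\<close>. If all these \<open>G\<close> satisfy
  \<open>|z G''(z)| < Re G'(z)\<close>, then \<open>\<phi> + cnj \<psi>\<close> is injective because every \<open>G\<close> is, and
  its image is convex because the tangent to the image of each circle \<open>|z| = r\<close> is a support line:
  for a normal \<open>N\<close> at \<open>z\<^sub>0\<close>, the component along \<open>N\<close> of \<open>\<phi> + cnj \<psi>\<close> is a positive multiple of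
  \<open>Re (G / (z\<^sub>0 G'(z\<^sub>0)))\<close> for \<open>\<epsilon> = N / cnj N\<close>, so the claim is the one for the convex analytic
  function \<open>G\<close>.

  At a minimum of \<open>Re P\<close> on a closed disc around 0 one has \<open>Re (z P'(z)) \<le> 0\<close>, so the hypothesis
  gives \<open>Re P > 0\<close> for \<open>P = h' + \<epsilon>g'\<close>. Hence the coefficients of \<open>P\<close> after the first are at most
  2, those of \<open>g'\<close> at most 1, and on \<open>|z| < 1/4\<close> one has \<open>Re P \<ge> 3/5\<close> and
  \<open>|z P'| \<le> 2/3 Re P\<close>. For \<open>p, q \<ge> 3\<close>, \<open>|P - G'| + |z(P' - G'')|\<close> is at most
  \<open>2 \<Sum>\<^sub>n\<^sub>\<ge>\<^sub>3 (n + 1) 4\<^sup>-\<^sup>n = 13/72 < 1/5\<close>; for \<open>p = 1\<close>, \<open>|1 - G'| + |z G''|\<close> is at most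
  \<open>\<Sum>\<^sub>n\<^sub>\<ge>\<^sub>1 (n + 1) 4\<^sup>-\<^sup>n = 7/9 < 1\<close>.
\<close>

subsection \<open>Harmonic maps with convex image\<close>

text \<open>Along the segment from \<open>w\<close> to \<open>z\<close>,
  \<open>Re (G / (z - w))\<close> has directional derivative \<open>Re G'\<close>, which is
  positive, so its end values differ.\<close>

lemma Noshiro_Warschawski:
  assumes "convex S" and der: "\<And>z. z \<in> S \<Longrightarrow> (G has_field_derivative G' z) (at z)"
    and pos: "\<And>z. z \<in> S \<Longrightarrow> 0 < Re (G' z)"
  shows "inj_on G S"
proof (rule inj_onI, rule ccontr)
  fix w z assume wz: "w \<in> S" "z \<in> S" "G w = G z" "w \<noteq> z"
  have seg: "closed_segment w z \<subseteq> S"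
    using wz \<open>convex S\<close> by (simp add: closed_segment_subset)
  have "\<exists>u. u \<in> closed_segment w z \<and> Re (G z / (z - w)) - Re (G w / (z - w)) = Re (G' u / (z - w) * (z - w))"
    using seg by (intro complex_mvt_line DERIV_cdivide der) auto
  then show False
    using seg pos wz by force
qed

section \<open>Support lines and convexity\<close>

lemma Re_has_real_derivative:
  assumes "(f has_vector_derivative v) (at t)"
  shows "((\<lambda>t. Re (f t)) has_real_derivative Re v) (at t)"
  using bounded_linear.has_vector_derivative[OF bounded_linear_Re assms]
  by (simp add: has_real_derivative_iff_has_vector_derivative)

lemma Im_has_real_derivative:
  assumes "(f has_vector_derivative v) (at t)"
  shows "((\<lambda>t. Im (f t)) has_real_derivative Im v) (at t)"
  using bounded_linear.has_vector_derivative[OF bounded_linear_Im assms]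
  by (simp add: has_real_derivative_iff_has_vector_derivative)

text \<open>The velocity of \<open>G (c t) / (z0 * deriv G z0)\<close> has argument
  \<open>A t + pi / 2\<close>. The derivative of \<open>A\<close> is the quantity in
  \<open>cvx\<close>, so the tangent never turns back; as \<open>Re (deriv G) > 0\<close>, the
  principal \<open>Ln\<close> is smooth along the circle and returns to its value, so the total turn
  is exactly \<open>2 * pi\<close>.\<close>

lemma convex_support_circle:
  assumes holG: "G holomorphic_on ball 0 R"
    and pos: "\<And>z. z \<in> ball 0 R \<Longrightarrow> 0 < Re (deriv G z)"
    and cvx: "\<And>z. z \<in> ball 0 R \<Longrightarrow> 0 \<le> Re (1 + z * deriv (deriv G) z / deriv G z)"
    and z0: "z0 \<noteq> 0" "cmod z0 < R" and "cmod z = cmod z0"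
  shows "Re (G z / (z0 * deriv G z0)) \<le> Re (G z0 / (z0 * deriv G z0))"
proof -
  define c where "c t = z0 * exp (\<i> * of_real t)" for t :: real
  \<comment> \<open>The tangent angle \<open>A\<close> increases from 0 to \<open>2 * pi\<close>, so \<open>u\<close> falls until \<open>A = pi\<close> and then rises.\<close>
  define A where "A t = t + Im (Ln (deriv G (c t))) - Im (Ln (deriv G z0))" for t
  define u where "u t = Re (G (c t) / (z0 * deriv G z0))" for t
  define v where "v t = - exp (Re (Ln (deriv G (c t)) - Ln (deriv G z0))) * sin (A t)" for t
  have c_in: "c t \<in> ball 0 R" for t
    using z0 by (simp add: c_def norm_mult)
  have z0_in: "z0 \<in> ball 0 R" using z0 by simp
  have holG': "deriv G holomorphic_on ball 0 R"
    using holG by (simp add: holomorphic_deriv)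
  have dc: "(c has_vector_derivative \<i> * c t) (at t)" for t
    unfolding c_def
    by (rule has_vector_derivative_real_field derivative_eq_intros refl | simp)+
  have nz: "deriv G w \<noteq> 0" if "w \<in> ball 0 R" for w
    using pos[OF that] by auto
  have dG: "(G has_field_derivative deriv G w) (at w)" if "w \<in> ball 0 R" for w
    using holG that holomorphic_derivI open_ball by blast
  have dG': "(deriv G has_field_derivative deriv (deriv G) w) (at w)" if "w \<in> ball 0 R" for w
    using holG' that holomorphic_derivI open_ball by blast
  have dA: "(A has_real_derivative Re (1 + c t * deriv (deriv G) (c t) / deriv G (c t))) (at t)" for t
  proof -
    have *: "((\<lambda>w. Ln (deriv G w)) has_field_derivative deriv (deriv G) (c t) / deriv G (c t)) (at (c t))"
      using pos[OF c_in] complex_nonpos_Reals_iff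
      by (auto intro!: derivative_eq_intros dG' c_in simp: divide_simps nz[OF c_in])
         (metis less_le_not_le)
    have "((\<lambda>t. Ln (deriv G (c t))) has_vector_derivative \<i> * (c t * deriv (deriv G) (c t) / deriv G (c t))) (at t)"
      using field_vector_diff_chain_at[OF dc *] by (simp add: o_def mult.assoc)
    from Im_has_real_derivative[OF this, unfolded Im_i_times]
    have "((\<lambda>t. t + Im (Ln (deriv G (c t))) - Im (Ln (deriv G z0))) has_real_derivative
        1 + Re (c t * deriv (deriv G) (c t) / deriv G (c t)) - 0) (at t)"
      by (intro DERIV_diff DERIV_add DERIV_ident DERIV_const)
    then show ?thesis
      by (simp add: A_def[abs_def])
  qed
  have du: "(u has_real_derivative v t) (at t)" for t
  proof -
    have "((\<lambda>t. G (c t)) has_vector_derivative \<i> * c t * deriv G (c t)) (at t)"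
      using field_vector_diff_chain_at[OF dc dG[OF c_in]] by (simp add: o_def)
    then have "((\<lambda>t. G (c t) / (z0 * deriv G z0)) has_vector_derivative \<i> * c t * deriv G (c t) / (z0 * deriv G z0)) (at t)"
      by (rule has_vector_derivative_divide)
    from Re_has_real_derivative[OF this]
    have "(u has_real_derivative Re (\<i> * c t * deriv G (c t) / (z0 * deriv G z0))) (at t)"
      by (simp add: u_def[abs_def])
    moreover have "\<i> * c t * deriv G (c t) / (z0 * deriv G z0)
        = \<i> * exp (\<i> * of_real t + (Ln (deriv G (c t)) - Ln (deriv G z0)))"
      using z0 nz[OF c_in, of t] nz[OF z0_in] by (simp add: c_def exp_add exp_diff)
    moreover have "Re (\<i> * exp (\<i> * of_real t + (Ln (deriv G (c t)) - Ln (deriv G z0)))) = v t"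
    proof -
      have "Im (\<i> * of_real t + (Ln (deriv G (c t)) - Ln (deriv G z0))) = A t"
        by (simp add: A_def)
      then show ?thesis
        by (simp only: v_def Re_i_times Im_exp) simp
    qed
    ultimately show ?thesis by simp
  qed
  have A0: "A 0 = 0" "A (2 * pi) = 2 * pi"
    by (auto simp: A_def c_def exp_two_pi_i mult_ac)
  have mono_A: "A s \<le> A t" if "s \<le> t" for s t
  proof (rule DERIV_nonneg_imp_nondecreasing[OF that])
    show "\<exists>y. (A has_real_derivative y) (at x) \<and> 0 \<le> y" for x
      using dA[of x] cvx[OF c_in[of x]] by blast
  qed
  have "continuous_on {0..2*pi} A"
    by (meson DERIV_continuous_on dA has_field_derivative_at_within)
  then obtain m where m: "0 \<le> m" "m \<le> 2 * pi" "A m = pi"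
    using IVT'[of A 0 pi "2 * pi"] A0 pi_ge_zero by force
  have decr: "u t \<le> u 0" if "0 \<le> t" "t \<le> m" for t
  proof (rule DERIV_nonpos_imp_nonincreasing[OF that(1)])
    fix x assume "0 \<le> x" "x \<le> t"
    then have "0 \<le> sin (A x)"
      using that m A0 mono_A[of 0 x] mono_A[of x m] by (intro sin_ge_zero) auto
    then show "\<exists>y. DERIV u x :> y \<and> y \<le> 0"
      using du by (auto simp: v_def intro!: exI[of _ "v x"])
  qed
  have incr: "u t \<le> u (2 * pi)" if "m \<le> t" "t \<le> 2 * pi" for t
  proof (rule DERIV_nonneg_imp_nondecreasing[OF that(2)])
    fix x assume "t \<le> x" "x \<le> 2 * pi"
    then have "0 \<le> sin (A x - pi)"
      using that m A0 mono_A[of m x] mono_A[of x "2*pi"] by (intro sin_ge_zero) auto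
    then have "sin (A x) \<le> 0" by (simp add: sin_diff)
    then show "\<exists>y. DERIV u x :> y \<and> 0 \<le> y"
      using du by (auto simp: v_def mult_nonneg_nonpos intro!: exI[of _ "v x"])
  qed
  have c0: "c 0 = z0" "c (2 * pi) = z0"
    by (simp_all add: c_def mult_ac exp_two_pi_i)
  have "cmod (z / z0) = 1"
    using assms by (simp add: norm_divide)
  then have "z / z0 = exp (\<i> * of_real (Arg2pi (z / z0)))"
    using complex_norm_eq_1_exp by metis
  moreover define t where "t = Arg2pi (z / z0)"
  moreover have t: "0 \<le> t" "t < 2 * pi"
    by (simp_all add: t_def Arg2pi_ge_0 Arg2pi_lt_2pi)
  ultimately have "z / z0 = exp (\<i> * of_real t)" by simp
  then have "z = c t" using z0 by (simp add: c_def field_simps)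
  moreover have "u t \<le> u 0"
    using decr[OF t(1)] incr[of t] t(2) c0 by (cases "t \<le> m") (simp_all add: u_def)
  ultimately show ?thesis
    by (simp add: u_def c0)
qed

text \<open>The maximum principle carries the bound from the circle to the disc it encloses.\<close>

lemma convex_support_disc:
  assumes holG: "G holomorphic_on ball 0 R"
    and pos: "\<And>z. z \<in> ball 0 R \<Longrightarrow> 0 < Re (deriv G z)"
    and cvx: "\<And>z. z \<in> ball 0 R \<Longrightarrow> 0 \<le> Re (1 + z * deriv (deriv G) z / deriv G z)"
    and z0: "z0 \<noteq> 0" "cmod z0 < R" and z: "cmod z \<le> cmod z0"
  shows "Re (G z / (z0 * deriv G z0)) \<le> Re (G z0 / (z0 * deriv G z0))"
proof (rule maximum_real_frontier[where S = "cball 0 (cmod z0)" and f = "\<lambda>z. G z / (z0 * deriv G z0)"])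
  have sub: "cball 0 (cmod z0) \<subseteq> ball 0 R" using z0 by auto
  have hol: "(\<lambda>z. G z / (z0 * deriv G z0)) holomorphic_on cball 0 (cmod z0)"
    using pos[of z0] z0 by (intro holomorphic_intros holomorphic_on_subset[OF holG sub]) auto
  then show "(\<lambda>z. G z / (z0 * deriv G z0)) holomorphic_on interior (cball 0 (cmod z0))"
    using interior_subset holomorphic_on_subset by blast
  show "continuous_on (closure (cball 0 (cmod z0))) (\<lambda>z. G z / (z0 * deriv G z0))"
    using hol by (simp add: holomorphic_on_imp_continuous_on)
  show "z \<in> cball 0 (cmod z0)" using z by simp
  show "Re (G w / (z0 * deriv G z0)) \<le> Re (G z0 / (z0 * deriv G z0))"
    if "w \<in> frontier (cball 0 (cmod z0))" for w
    using convex_support_circle[OF holG pos cvx z0, of w] that z0 by simp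
qed simp

text \<open>\<open>S\<close> is the intersection of all closed half-spaces containing it: the
  segment from an interior point \<open>x\<close> to a point \<open>y\<close> outside
  \<open>S\<close> meets the frontier at some \<open>b\<close>, and the support functional at
  \<open>b\<close> is strictly smaller at \<open>x\<close> than at \<open>b\<close>, hence strictly
  larger at \<open>y\<close>.\<close>

lemma convex_if_supported:
  fixes S :: "'a::euclidean_space set"
  assumes "closed S" and ne: "interior S \<noteq> {}"
    and supp: "\<And>b. b \<in> frontier S \<Longrightarrow> \<exists>a. a \<noteq> 0 \<and> (\<forall>x\<in>S. a \<bullet> x \<le> a \<bullet> b)"
  shows "convex S"
proof -
  define H where "H = {(a, b). (\<forall>x\<in>S. a \<bullet> x \<le> b)}"
  have "y \<in> S" if y: "\<And>a b. (a, b) \<in> H \<Longrightarrow> a \<bullet> y \<le> b" for y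
  proof (rule ccontr)
    assume "y \<notin> S"
    obtain x where x: "x \<in> interior S" using ne by blast
    then have "x \<in> S" using interior_subset by blast
    have "closed_segment x y \<inter> frontier S \<noteq> {}"
      using \<open>x \<in> S\<close> \<open>y \<notin> S\<close> by (intro connected_Int_frontier) auto
    then obtain b where b: "b \<in> closed_segment x y" "b \<in> frontier S" by blast
    obtain a where a: "a \<noteq> 0" "\<And>x. x \<in> S \<Longrightarrow> a \<bullet> x \<le> a \<bullet> b" using supp[OF b(2)] by blast
    obtain e where e: "e > 0" "ball x e \<subseteq> S" using x by (meson mem_interior)
    have "x + (e / 2 / norm a) *\<^sub>R a \<in> ball x e"
      using a e by (simp add: dist_norm)
    then have "a \<bullet> (x + (e / 2 / norm a) *\<^sub>R a) \<le> a \<bullet> b" using a e by blast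
    moreover have "(e / 2 / norm a) * (a \<bullet> a) > 0" using a e by simp
    ultimately have lt: "a \<bullet> x < a \<bullet> b" by (simp add: inner_add_right)
    have yb: "a \<bullet> y \<le> a \<bullet> b" using y[of a "a \<bullet> b"] a by (auto simp: H_def)
    have "y \<noteq> b" using b \<open>y \<notin> S\<close> \<open>closed S\<close> frontier_subset_closed by blast
    obtain s where s: "0 \<le> s" "s \<le> 1" "b = (1 - s) *\<^sub>R x + s *\<^sub>R y"
      using b(1) by (auto simp: in_segment)
    with \<open>y \<noteq> b\<close> have "s < 1" by (cases "s = 1") auto
    then have "(1 - s) * (a \<bullet> x) < (1 - s) * (a \<bullet> b)" using lt by simp
    moreover have "s * (a \<bullet> y) \<le> s * (a \<bullet> b)" using yb s by (simp add: mult_left_mono)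
    moreover have "a \<bullet> b = (1 - s) * (a \<bullet> x) + s * (a \<bullet> y)"
      by (subst s(3)) (simp add: inner_add_right)
    ultimately show False by (simp add: algebra_simps)
  qed
  then have "S = (\<Inter>(a, b)\<in>H. {x. a \<bullet> x \<le> b})"
    by (auto simp: H_def)
  moreover have "convex (\<Inter>(a, b)\<in>H. {x. a \<bullet> x \<le> b})"
    by (auto intro!: convex_INT simp: convex_halfspace_le)
  ultimately show ?thesis by simp
qed

text \<open>Images of closed discs of radius \<open>r < R\<close> are compact, so their convexity
  follows from support lines at frontier points; the open disc is an increasing union of such discs.
  Injectivity and each support line call for their own \<open>\<epsilon>\<close>.\<close>

lemma harmonic_convex_map:
  assumes "0 < R" and hol: "\<phi> holomorphic_on ball 0 R" "\<psi> holomorphic_on ball 0 R"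
    and pos: "\<And>\<epsilon> z. cmod \<epsilon> = 1 \<Longrightarrow> z \<in> ball 0 R \<Longrightarrow> 0 < Re (deriv \<phi> z + \<epsilon> * deriv \<psi> z)"
    and cvx: "\<And>\<epsilon> z. cmod \<epsilon> = 1 \<Longrightarrow> z \<in> ball 0 R \<Longrightarrow>
       0 \<le> Re (1 + z * (deriv (deriv \<phi>) z + \<epsilon> * deriv (deriv \<psi>) z) / (deriv \<phi> z + \<epsilon> * deriv \<psi> z))"
  shows "convex_map_on (\<lambda>z. \<phi> z + cnj (\<psi> z)) (ball 0 R)"
proof -
  define f where "f z = \<phi> z + cnj (\<psi> z)" for z
  define G where "G \<epsilon> z = \<phi> z + \<epsilon> * \<psi> z" for \<epsilon> z
  have d1: "(\<phi> has_field_derivative deriv \<phi> z) (at z)" "(\<psi> has_field_derivative deriv \<psi> z) (at z)"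
    if "z \<in> ball 0 R" for z
    using hol that holomorphic_derivI open_ball by blast+
  have hol': "deriv \<phi> holomorphic_on ball 0 R" "deriv \<psi> holomorphic_on ball 0 R"
    using hol by (auto intro: holomorphic_deriv)
  have d2: "(deriv \<phi> has_field_derivative deriv (deriv \<phi>) z) (at z)"
           "(deriv \<psi> has_field_derivative deriv (deriv \<psi>) z) (at z)"
    if "z \<in> ball 0 R" for z
    using hol' that holomorphic_derivI open_ball by blast+
  have holG: "G \<epsilon> holomorphic_on ball 0 R" for \<epsilon>
    unfolding G_def by (intro holomorphic_intros hol)
  have dG: "(G \<epsilon> has_field_derivative deriv \<phi> z + \<epsilon> * deriv \<psi> z) (at z)" if "z \<in> ball 0 R" for z \<epsilon>
    unfolding G_def using d1[OF that] by (auto intro!: derivative_eq_intros)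
  then have derG: "deriv (G \<epsilon>) z = deriv \<phi> z + \<epsilon> * deriv \<psi> z" if "z \<in> ball 0 R" for z \<epsilon>
    using that DERIV_imp_deriv by blast
  have derG2: "deriv (deriv (G \<epsilon>)) z = deriv (deriv \<phi>) z + \<epsilon> * deriv (deriv \<psi>) z"
    if "z \<in> ball 0 R" for z \<epsilon>
  proof (rule DERIV_imp_deriv)
    have "((\<lambda>z. deriv \<phi> z + \<epsilon> * deriv \<psi> z) has_field_derivative
        deriv (deriv \<phi>) z + \<epsilon> * deriv (deriv \<psi>) z) (at z)"
      using d2[OF that] by (auto intro!: derivative_eq_intros)
    then show "(deriv (G \<epsilon>) has_field_derivative deriv (deriv \<phi>) z + \<epsilon> * deriv (deriv \<psi>) z) (at z)"
      by (rule has_field_derivative_transform_within_open[of _ _ _ "ball 0 R"]) (use that derG in auto)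
  qed
  have inj: "inj_on f (ball 0 R)"
  proof (rule inj_onI)
    fix w z assume wz: "w \<in> ball 0 R" "z \<in> ball 0 R" "f w = f z"
    define a b where "a = \<phi> w - \<phi> z" and "b = \<psi> w - \<psi> z"
    have ab: "a = - cnj b" using wz(3) by (simp add: f_def a_def b_def algebra_simps)
    \<comment> \<open>The factor \<open>cnj b / b\<close> turns \<open>b\<close> into
      \<open>cnj b\<close>, so \<open>a = - cnj b\<close> becomes an equality of two values of the
      analytic \<open>G \<epsilon>\<close>.\<close>
    obtain \<epsilon> where e: "cmod \<epsilon> = 1" "a + \<epsilon> * b = 0"
    proof (cases "b = 0")
      case True then show ?thesis using that[of 1] ab by simp
    next
      case False
      then show ?thesis using that[of "cnj b / b"] ab by (simp add: norm_divide)
    qed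
    have "inj_on (G \<epsilon>) (ball 0 R)"
      using Noshiro_Warschawski[OF convex_ball dG] pos[OF e(1)] by blast
    moreover have "G \<epsilon> w = G \<epsilon> z"
      using e(2) by (simp add: G_def a_def b_def algebra_simps)
    ultimately show "w = z" using wz by (auto dest: inj_onD)
  qed
  have contf: "continuous_on (ball 0 R) f"
    unfolding f_def using hol by (intro continuous_intros) (auto intro: holomorphic_on_imp_continuous_on)
  have supp: "\<exists>a. a \<noteq> 0 \<and> (\<forall>z. cmod z \<le> cmod z0 \<longrightarrow> a \<bullet> f z \<le> a \<bullet> f z0)"
    if z0: "z0 \<noteq> 0" "cmod z0 < R" for z0
  proof -
    \<comment> \<open>\<open>N\<close> is the outer normal at \<open>f z0\<close> of the image of the circle through \<open>z0\<close>.\<close>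
    define N where "N = z0 * deriv \<phi> z0 - cnj (z0 * deriv \<psi> z0)"
    define \<epsilon> where "\<epsilon> = N / cnj N"
    define k where "k = (cmod (deriv \<phi> z0))\<^sup>2 - (cmod (deriv \<psi> z0))\<^sup>2"
    have z0_in: "z0 \<in> ball 0 R" using z0 by simp
    \<comment> \<open>Rotating \<open>deriv \<psi> z0\<close> onto the negative real axis gives the
      worst case of \<open>pos\<close>. It follows that the Jacobian \<open>k\<close> is
      positive.\<close>
    have lt: "cmod (deriv \<psi> z0) < cmod (deriv \<phi> z0)"
    proof (cases "deriv \<psi> z0 = 0")
      case True then show ?thesis using pos[of 1 z0] z0_in by auto
    next
      case False
      have "0 < Re (deriv \<phi> z0 + (- cmod (deriv \<psi> z0) / deriv \<psi> z0) * deriv \<psi> z0)"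
        using False by (intro pos z0_in) (simp add: norm_divide)
      then have "cmod (deriv \<psi> z0) < Re (deriv \<phi> z0)" using False by simp
      then show ?thesis using complex_Re_le_cmod[of "deriv \<phi> z0"] by linarith
    qed
    then have k: "k > 0" by (simp add: k_def power_strict_mono)
    have N: "N \<noteq> 0"
    proof
      assume "N = 0"
      then have "z0 * deriv \<phi> z0 = cnj (z0 * deriv \<psi> z0)" by (simp add: N_def)
      then have "cmod (z0 * deriv \<phi> z0) = cmod (cnj (z0 * deriv \<psi> z0))" by simp
      then show False using lt z0 by (simp add: norm_mult)
    qed
    have e: "cmod \<epsilon> = 1" using N by (simp add: \<epsilon>_def norm_divide)
    \<comment> \<open>Since \<open>cnj N * \<epsilon> = N\<close>, the mixed terms cancel. Hence
      \<open>cnj N\<close> is a positive multiple of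
      \<open>1 / (z0 * deriv (G \<epsilon>) z0)\<close>, the normalisation in
      \<open>convex_support_disc\<close>.\<close>
    have Nk: "cnj N * (z0 * deriv (G \<epsilon>) z0) = of_real ((cmod z0)\<^sup>2 * k)"
    proof -
      have "cnj N * (z0 * deriv (G \<epsilon>) z0) = cnj N * (z0 * deriv \<phi> z0) + N * (z0 * deriv \<psi> z0)"
        using N by (simp add: derG[OF z0_in] \<epsilon>_def field_simps)
      also have "\<dots> = (z0 * cnj z0) * (deriv \<phi> z0 * cnj (deriv \<phi> z0) - deriv \<psi> z0 * cnj (deriv \<psi> z0))"
        by (simp add: N_def algebra_simps)
      finally show ?thesis by (simp add: k_def flip: complex_norm_square)
    qed
    have "N \<bullet> f z \<le> N \<bullet> f z0" if z: "cmod z \<le> cmod z0" for z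
    proof -
      have pos': "0 < (cmod z0)\<^sup>2 * k" using k z0 by simp
      have Gz: "N \<bullet> f w = (cmod z0)\<^sup>2 * k * Re (G \<epsilon> w / (z0 * deriv (G \<epsilon>) z0))" for w
      proof -
        \<comment> \<open>Conjugation preserves real parts, so \<open>cnj N * cnj (\<psi> w)\<close>
          may be replaced by \<open>N * \<psi> w\<close>.\<close>
        have "N \<bullet> f w = Re (cnj N * \<phi> w + N * \<psi> w)"
          by (simp add: inner_complex_def f_def algebra_simps)
        also have "cnj N * \<phi> w + N * \<psi> w = cnj N * G \<epsilon> w"
          using N by (simp add: G_def \<epsilon>_def field_simps)
        also have "cnj N * G \<epsilon> w = of_real ((cmod z0)\<^sup>2 * k) * (G \<epsilon> w / (z0 * deriv (G \<epsilon>) z0))"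
        proof -
          have "z0 * deriv (G \<epsilon>) z0 \<noteq> 0" using Nk pos' by auto
          then show ?thesis by (subst Nk[symmetric]) simp
        qed
        finally show ?thesis
          by (simp only: scaleR_conv_of_real[symmetric] scaleR_complex.sel)
      qed
      have "Re (G \<epsilon> z / (z0 * deriv (G \<epsilon>) z0)) \<le> Re (G \<epsilon> z0 / (z0 * deriv (G \<epsilon>) z0))"
        using pos[OF e] cvx[OF e] derG derG2
        by (intro convex_support_disc[OF holG _ _ z0 z]) simp_all
      then show ?thesis unfolding Gz using pos' by (intro mult_left_mono) auto
    qed
    then show ?thesis using N by blast
  qed
  have conv: "convex (f ` cball 0 r)" if r: "0 < r" "r < R" for r
  proof (rule convex_if_supported)
    have sub: "cball (0::complex) r \<subseteq> ball 0 R" using r by auto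
    \<comment> \<open>By invariance of domain the open disc has open image, so a frontier point can
      only come from the bounding circle.\<close>
    have op: "open (f ` ball 0 r)"
      using r by (intro invariance_of_domain_ball continuous_on_subset[OF contf sub]
          inj_on_subset[OF inj sub]) auto
    have int: "f ` ball 0 r \<subseteq> interior (f ` cball 0 r)"
      by (intro interior_maximal op image_mono) auto
    show cl: "closed (f ` cball 0 r)"
      by (intro compact_imp_closed compact_continuous_image continuous_on_subset[OF contf sub]) auto
    have "f 0 \<in> f ` ball 0 r" using r by auto
    then show "interior (f ` cball 0 r) \<noteq> {}" using int by blast
    fix b assume b: "b \<in> frontier (f ` cball 0 r)"
    then obtain z0 where z0: "b = f z0" "cmod z0 \<le> r"
      using cl frontier_subset_closed by (metis (no_types, lifting) image_iff mem_cball_0 subsetD)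
    moreover have "z0 \<notin> ball 0 r" using b z0(1) int unfolding frontier_def by blast
    ultimately have z0r: "cmod z0 = r" by simp
    then have "z0 \<noteq> 0" "cmod z0 < R" using r by auto
    from supp[OF this, unfolded z0r] obtain a
      where "a \<noteq> 0" "\<forall>z. cmod z \<le> r \<longrightarrow> a \<bullet> f z \<le> a \<bullet> f z0" by blast
    then show "\<exists>a. a \<noteq> 0 \<and> (\<forall>x\<in>f ` cball 0 r. a \<bullet> x \<le> a \<bullet> b)"
      using z0(1) by (intro exI[of _ a]) simp
  qed
  have "convex (f ` ball 0 R)"
  proof (rule convexI)
    fix x y :: complex and s t :: real
    assume "x \<in> f ` ball 0 R" "y \<in> f ` ball 0 R" and st: "0 \<le> s" "0 \<le> t" "s + t = 1"
    then obtain a b where ab: "x = f a" "cmod a < R" "y = f b" "cmod b < R" by auto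
    obtain r where r: "max (cmod a) (cmod b) < r" "r < R"
      using dense[of "max (cmod a) (cmod b)" R] ab by auto
    then have r0: "0 < r" using norm_ge_zero[of a] by linarith
    have "s *\<^sub>R x + t *\<^sub>R y \<in> f ` cball 0 r"
      using r ab st by (intro convexD[OF conv[OF r0 r(2)]]) auto
    then show "s *\<^sub>R x + t *\<^sub>R y \<in> f ` ball 0 R" using r by force
  qed
  with inj show ?thesis by (simp add: convex_map_on_def f_def[abs_def])
qed

subsection \<open>Functions with positive real part\<close>

text \<open>Cauchy's formula for derivatives, scaled by \<open>r ^ n / (2 * pi * \<i>)\<close>:
  Taylor coefficients are Fourier coefficients on a circle, ready for estimates under the
  integral.\<close>

lemma taylor_coeff_has_integral:
  assumes hol: "f holomorphic_on ball a R" and r: "0 < r" "r < R"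
  shows "((\<lambda>t. f (circlepath a r t) * exp (- (2 * of_real pi * \<i> * of_real t)) ^ n)
     has_integral (deriv ^^ n) f a / fact n * of_real r ^ n) {0..1}"
proof -
  define w where "w t = exp (2 * of_real pi * \<i> * of_real t)" for t :: real
  have sub: "cball a r \<subseteq> ball a R" using r by auto
  have "((\<lambda>u. f u / (u - a) ^ Suc n) has_contour_integral (2 * pi * \<i>) / fact n * (deriv ^^ n) f a)
      (circlepath a r)"
  proof (rule Cauchy_has_contour_integral_higher_derivative_circlepath)
    show "continuous_on (cball a r) f"
      using hol sub holomorphic_on_imp_continuous_on continuous_on_subset by blast
    show "f holomorphic_on ball a r"
      using hol sub ball_subset_cball holomorphic_on_subset by (metis dual_order.trans)
  qed (use r in auto)
  then have "((\<lambda>t. f (circlepath a r t) / (circlepath a r t - a) ^ Suc n *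
        vector_derivative (circlepath a r) (at t)) has_integral
      (2 * pi * \<i>) / fact n * (deriv ^^ n) f a) {0..1}"
    by (simp add: has_contour_integral)
  then have "((\<lambda>t. (of_real r ^ n / (2 * pi * \<i>)) * (f (circlepath a r t) / (circlepath a r t - a) ^ Suc n *
        vector_derivative (circlepath a r) (at t))) has_integral
      (of_real r ^ n / (2 * pi * \<i>)) * ((2 * pi * \<i>) / fact n * (deriv ^^ n) f a)) {0..1}"
    by (rule has_integral_mult_right)
  moreover have "(of_real r ^ n / (2 * pi * \<i>)) * (f (circlepath a r t) / (circlepath a r t - a) ^ Suc n *
        vector_derivative (circlepath a r) (at t)) =
      f (circlepath a r t) * exp (- (2 * of_real pi * \<i> * of_real t)) ^ n" for t
  proof -
    have c: "circlepath a r t - a = of_real r * w t"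
      by (simp add: circlepath w_def)
    have v: "vector_derivative (circlepath a r) (at t) = 2 * pi * \<i> * r * w t"
      by (simp add: vector_derivative_circlepath w_def)
    have e: "exp (- (2 * of_real pi * \<i> * of_real t)) = inverse (w t)"
      by (simp add: w_def exp_minus)
    have "w t \<noteq> 0" by (simp add: w_def)
    then show ?thesis
      unfolding c v e using r by (simp add: field_simps)
  qed
  moreover have "(of_real r ^ n / (2 * pi * \<i>)) * ((2 * pi * \<i>) / fact n * (deriv ^^ n) f a)
      = (deriv ^^ n) f a / fact n * of_real r ^ n"
  proof -
    have "x / c * (c / y * d) = d / y * x" if "c \<noteq> 0" for x c y d :: complex
      using that by simp
    from this[of "2 * pi * \<i>"] show ?thesis by (simp only: mult_eq_0_iff) simp
  qed
  ultimately show ?thesis by simp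
qed

text \<open>On the circle the exponential factor is \<open>((z - a) / r) ^ n\<close>, so the
  integral is the mean of a holomorphic function vanishing at the centre.\<close>

lemma positive_frequency_has_integral_0:
  assumes hol: "f holomorphic_on ball a R" and r: "0 < r" "r < R" and n: "n \<ge> 1"
  shows "((\<lambda>t. f (circlepath a r t) * exp (2 * of_real pi * \<i> * of_real t) ^ n) has_integral 0) {0..1}"
proof -
  have "(\<lambda>z. f z * ((z - a) / of_real r) ^ n) holomorphic_on ball a R"
    using r by (intro holomorphic_intros hol) auto
  from taylor_coeff_has_integral[OF this r, of 0] show ?thesis
    using r n by (simp add: circlepath power_0_left)
qed

text \<open>The integrals live on circles inside the open ball; letting \<open>r\<close> tend to
  \<open>R\<close> gives the bound at full radius.\<close>

lemma power_bound_limit: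
  fixes c K R :: real
  assumes "0 < R" and "\<And>r. 0 < r \<Longrightarrow> r < R \<Longrightarrow> c * r ^ n \<le> K"
  shows "c * R ^ n \<le> K"
proof (rule tendsto_upperbound)
  show "((\<lambda>r. c * r ^ n) \<longlongrightarrow> c * R ^ n) (at_left R)"
    by (intro tendsto_intros)
  show "\<forall>\<^sub>F r in at_left R. c * r ^ n \<le> K"
    using eventually_at_left_real[OF \<open>0 < R\<close>] by eventually_elim (use assms in auto)
qed simp

text \<open>The coefficient integral of \<open>g\<close> is at most the mean of \<open>Re f\<close>
  on the circle, which is \<open>Re (f a)\<close>.\<close>

lemma taylor_coeff_bound_dominated:
  assumes hol: "f holomorphic_on ball a R" "g holomorphic_on ball a R" and "0 < R"
    and le: "\<And>z. z \<in> ball a R \<Longrightarrow> cmod (g z) \<le> Re (f z)"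
  shows "cmod ((deriv ^^ n) g a / fact n) * R ^ n \<le> Re (f a)"
proof (rule power_bound_limit[OF \<open>0 < R\<close>])
  fix r :: real assume r: "0 < r" "r < R"
  have in_ball: "circlepath a r t \<in> ball a R" for t
    using r by (simp add: circlepath dist_norm norm_mult)
  note I = taylor_coeff_has_integral[OF hol(2) r, of n]
  have "((\<lambda>t. f (circlepath a r t)) has_integral f a) {0..1}"
    using taylor_coeff_has_integral[OF hol(1) r, of 0] by simp
  from has_integral_linear[OF this bounded_linear_Re]
  have J: "((\<lambda>t. Re (f (circlepath a r t))) has_integral Re (f a)) {0..1}" by (simp add: o_def)
  have "cmod (integral {0..1} (\<lambda>t. g (circlepath a r t) * exp (- (2 * of_real pi * \<i> * of_real t)) ^ n))
      \<le> integral {0..1} (\<lambda>t. Re (f (circlepath a r t)))"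
    using I J le[OF in_ball]
    by (intro integral_norm_bound_integral) (auto simp: norm_mult norm_power)
  then have "cmod ((deriv ^^ n) g a / fact n * of_real r ^ n) \<le> Re (f a)"
    using I J by (simp only: integral_unique)
  then show "cmod ((deriv ^^ n) g a / fact n) * r ^ n \<le> Re (f a)"
    using r by (simp add: norm_mult norm_divide norm_power)
qed

text \<open>Caratheodory's inequality: adding the conjugate of the vanishing positive-frequency
  integral replaces \<open>f\<close> by \<open>2 * Re f\<close>, which is its own absolute value and
  has mean \<open>2 * Re (f a)\<close>.\<close>

lemma taylor_coeff_bound_Re_pos:
  assumes hol: "f holomorphic_on ball a R" and "0 < R" and "n \<ge> 1"
    and pos: "\<And>z. z \<in> ball a R \<Longrightarrow> 0 \<le> Re (f z)"
  shows "cmod ((deriv ^^ n) f a / fact n) * R ^ n \<le> 2 * Re (f a)"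
proof (rule power_bound_limit[OF \<open>0 < R\<close>])
  fix r :: real assume r: "0 < r" "r < R"
  have in_ball: "circlepath a r t \<in> ball a R" for t
    using r by (simp add: circlepath dist_norm norm_mult)
  define E where "E t = exp (- (2 * of_real pi * \<i> * of_real t)) ^ n" for t :: real
  have E: "cnj (exp (2 * of_real pi * \<i> * of_real t) ^ n) = E t" "cmod (E t) = 1" for t
    by (simp_all add: E_def exp_cnj norm_power)
  have "((\<lambda>t. f (circlepath a r t)) has_integral f a) {0..1}"
    using taylor_coeff_has_integral[OF hol(1) r, of 0] by simp
  from has_integral_mult_right[OF has_integral_linear[OF this bounded_linear_Re], of 2]
  have J: "((\<lambda>t. 2 * Re (f (circlepath a r t))) has_integral 2 * Re (f a)) {0..1}" by (simp add: o_def)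
  have "((\<lambda>t. cnj (f (circlepath a r t)) * E t) has_integral 0) {0..1}"
    using has_integral_linear[OF positive_frequency_has_integral_0[OF hol r \<open>n \<ge> 1\<close>] bounded_linear_cnj]
    by (simp only: o_def complex_cnj_mult E complex_cnj_zero)
  from has_integral_add[OF taylor_coeff_has_integral[OF hol r, of n, folded E_def] this]
  have I: "((\<lambda>t. of_real (2 * Re (f (circlepath a r t))) * E t) has_integral
      (deriv ^^ n) f a / fact n * of_real r ^ n) {0..1}"
    by (simp add: complex_add_cnj flip: distrib_right)
  have "cmod (integral {0..1} (\<lambda>t. of_real (2 * Re (f (circlepath a r t))) * E t))
      \<le> integral {0..1} (\<lambda>t. 2 * Re (f (circlepath a r t)))"
    using I J pos[OF in_ball]
    by (intro integral_norm_bound_integral) (auto simp: norm_mult E)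
  then have "cmod ((deriv ^^ n) f a / fact n * of_real r ^ n) \<le> 2 * Re (f a)"
    using I J by (simp only: integral_unique)
  then show "cmod ((deriv ^^ n) f a / fact n) * r ^ n \<le> 2 * Re (f a)"
    using r by (simp add: norm_mult norm_divide norm_power)
qed

text \<open>The Cayley transform \<open>(P - 1) / (P + 1)\<close> maps into the unit disc and
  vanishes at 0. The Schwarz lemma bounds it by \<open>cmod z\<close>, and solving for
  \<open>Re (P z)\<close> gives this Harnack bound.\<close>

lemma Re_pos_lower_bound:
  assumes hol: "P holomorphic_on ball 0 1" and pos: "\<And>z. z \<in> ball 0 1 \<Longrightarrow> 0 < Re (P z)"
    and P0: "P 0 = 1" and z: "cmod z < 1"
  shows "(1 - cmod z) / (1 + cmod z) \<le> Re (P z)"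
proof (rule ccontr)
  assume neg: "\<not> ?thesis"
  have nz: "P w + 1 \<noteq> 0" if "w \<in> ball 0 1" for w
    using pos[OF that] by (auto simp: complex_eq_iff)
  define r where "r = cmod z"
  have r: "0 \<le> r" "r < 1" using z by (auto simp: r_def)
  have lt: "cmod (P w - 1) < cmod (P w + 1)" if "w \<in> ball 0 1" for w
    using pos[OF that] by (simp add: cmod_def power2_eq_square algebra_simps)
  have "cmod ((P z - 1) / (P z + 1)) \<le> cmod z"
  proof (rule Schwarz_Lemma(1)[of "\<lambda>z. (P z - 1) / (P z + 1)"])
    show "(\<lambda>z. (P z - 1) / (P z + 1)) holomorphic_on ball 0 1"
      using nz by (intro holomorphic_intros hol) auto
    show "cmod ((P w - 1) / (P w + 1)) < 1" if "cmod w < 1" for w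
      using lt[of w] nz[of w] that by (simp add: norm_divide divide_simps)
  qed (use P0 z in auto)
  then have "cmod (P z - 1) \<le> r * cmod (P z + 1)"
    using nz[of z] z by (simp add: norm_divide r_def field_simps)
  then have "(cmod (P z - 1))\<^sup>2 \<le> (r * cmod (P z + 1))\<^sup>2"
    by (simp add: power_mono)
  then have le: "(1 - Re (P z))\<^sup>2 + (Im (P z))\<^sup>2 \<le> (r * (1 + Re (P z)))\<^sup>2 + r\<^sup>2 * (Im (P z))\<^sup>2"
    by (simp add: cmod_power2 power_mult_distrib power2_commute[of 1] add.commute[of 1] flip: distrib_left)
  have "Re (P z) * (1 + r) < 1 - r"
    using neg r by (simp only: not_le r_def) (simp add: pos_less_divide_eq)
  then have "r * (1 + Re (P z)) < 1 - Re (P z)" by (simp add: algebra_simps)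
  then have "(r * (1 + Re (P z)))\<^sup>2 < (1 - Re (P z))\<^sup>2"
    using r pos[of z] z by (intro power_strict_mono) auto
  moreover have "r\<^sup>2 * (Im (P z))\<^sup>2 \<le> (Im (P z))\<^sup>2"
    using r by (simp add: mult_left_le_one_le power_le_one)
  ultimately show False using le by linarith
qed

lemma Re_pos_if_Re_Euler_pos:
  assumes "0 \<le> \<alpha>" and hol: "P holomorphic_on ball 0 1"
    and pos: "\<And>z. z \<in> ball 0 1 \<Longrightarrow> 0 < Re (P z + of_real \<alpha> * z * deriv P z)"
    and z: "z \<in> ball 0 1"
  shows "0 < Re (P z)"
proof -
  have sub: "cball 0 (cmod z) \<subseteq> ball 0 1" using z by auto
  have "continuous_on (cball 0 (cmod z)) (\<lambda>z. Re (P z))"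
    using hol sub by (intro continuous_intros) (blast intro: continuous_on_subset holomorphic_on_imp_continuous_on)
  then obtain w where w: "w \<in> cball 0 (cmod z)" "\<And>u. u \<in> cball 0 (cmod z) \<Longrightarrow> Re (P w) \<le> Re (P u)"
    using continuous_attains_inf[of "cball 0 (cmod z)" "\<lambda>z. Re (P z)"] by auto
  have w1: "w \<in> ball 0 1" using w sub by blast
  \<comment> \<open>A positive radial derivative at \<open>w\<close> would give smaller values of
    \<open>Re P\<close> slightly further inside, still in the closed disc.\<close>
  have "Re (w * deriv P w) \<le> 0"
  proof (rule ccontr)
    assume "\<not> ?thesis"
    then have gt: "0 < Re (w * deriv P w)" by simp
    have "((\<lambda>t::real. of_real t * w) has_vector_derivative w) (at 1)"
      by (rule has_vector_derivative_real_field derivative_eq_intros refl | simp)+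
    from field_vector_diff_chain_at[OF this, of P "deriv P w"]
    have "((\<lambda>t. P (of_real t * w)) has_vector_derivative w * deriv P w) (at 1)"
      using holomorphic_derivI[OF hol open_ball w1] by (simp add: o_def)
    from DERIV_pos_inc_left[OF Re_has_real_derivative[OF this] gt] obtain d where d: "d > 0"
      "\<forall>h>0. h < d \<longrightarrow> Re (P (of_real (1 - h) * w)) < Re (P (of_real 1 * w))"
      by blast
    define k where "k = min (d / 2) 1"
    have k: "0 < k" "k < d" "k \<le> 1" using d by (auto simp: k_def)
    have "cmod (of_real (1 - k) * w) \<le> cmod w"
      using k unfolding norm_mult norm_of_real by (intro mult_left_le_one_le) auto
    then have "Re (P w) \<le> Re (P (of_real (1 - k) * w))" using w by auto
    with d(2) k(1,2) show False by fastforce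
  qed
  then have "\<alpha> * Re (w * deriv P w) \<le> 0" using \<open>0 \<le> \<alpha>\<close> by (simp add: mult_nonneg_nonpos)
  moreover have "Re (P w + of_real \<alpha> * w * deriv P w) = Re (P w) + \<alpha> * Re (w * deriv P w)"
    by (simp add: mult.assoc)
  ultimately have "0 < Re (P w)" using pos[OF w1] by linarith
  also have "\<dots> \<le> Re (P z)" using w by simp
  finally show ?thesis .
qed

section \<open>Power series, Euler derivatives and tails\<close>

lemma Euler_derivative_sums:
  assumes "f holomorphic_on ball 0 R" and z: "z \<in> ball 0 R"
  shows "(\<lambda>n. of_nat n * ((deriv ^^ n) f 0 / fact n) * z ^ n) sums (z * deriv f z)"
proof -
  have "deriv f holomorphic_on ball 0 R"
    using assms by (simp add: holomorphic_deriv)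
  from sums_mult[OF holomorphic_power_series[OF this z], of z]
  have "(\<lambda>n. z * ((deriv ^^ n) (deriv f) 0 / fact n * z ^ n)) sums (z * deriv f z)" by simp
  moreover have "z * ((deriv ^^ n) (deriv f) 0 / fact n * z ^ n) =
      of_nat (Suc n) * ((deriv ^^ Suc n) f 0 / fact (Suc n)) * z ^ Suc n" for n
    by (simp add: funpow_swap1 fact_reduce field_simps del: of_nat_Suc)
  ultimately have "(\<lambda>n. of_nat (Suc n) * ((deriv ^^ Suc n) f 0 / fact (Suc n)) * z ^ Suc n) sums (z * deriv f z)"
    by simp
  from sums_Suc[OF this] show ?thesis by simp
qed

text \<open>The two \<open>n\<close>-th terms together have norm
  \<open>cmod (e n) * Suc n * cmod z ^ n\<close>, and \<open>Suc n * \<rho> ^ n\<close> sums to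
  \<open>1 / (1 - \<rho>)\<^sup>2\<close>. The errors are bounded jointly because both are paid from
  one margin in the final comparison.\<close>

lemma power_series_tail_bound:
  fixes e :: "nat \<Rightarrow> complex"
  assumes E1: "(\<lambda>n. e n * z ^ n) sums E1" and E2: "(\<lambda>n. of_nat n * e n * z ^ n) sums E2"
    and e0: "\<And>n. n < m \<Longrightarrow> e n = 0" and e1: "\<And>n. cmod (e n) \<le> C"
    and z: "cmod z \<le> \<rho>" and \<rho>: "\<rho> < 1"
  shows "cmod E1 + cmod E2 \<le> C * (1 / (1 - \<rho>)\<^sup>2 - (\<Sum>n<m. of_nat (Suc n) * \<rho> ^ n))"
proof -
  have \<rho>0: "0 \<le> \<rho>" using z norm_ge_zero[of z] by linarith
  define b where "b n = C * (of_nat (Suc n) * \<rho> ^ n - (if n \<in> {..<m} then of_nat (Suc n) * \<rho> ^ n else 0))" for n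
  have b: "b sums (C * (1 / (1 - \<rho>)\<^sup>2 - (\<Sum>n<m. of_nat (Suc n) * \<rho> ^ n)))"
    unfolding b_def using \<rho> \<rho>0
    by (intro sums_mult sums_diff geometric_deriv_sums sums_If_finite_set) auto
  have le: "cmod (e n * z ^ n) + cmod (of_nat n * e n * z ^ n) \<le> b n" for n
  proof (cases "n < m")
    case True then show ?thesis by (simp add: e0 b_def)
  next
    case False
    have "cmod (e n * z ^ n) + cmod (of_nat n * e n * z ^ n) = cmod (e n) * (of_nat (Suc n) * cmod z ^ n)"
      by (simp add: norm_mult norm_power algebra_simps)
    also have "\<dots> \<le> C * (of_nat (Suc n) * \<rho> ^ n)"
      using z e1[of n] order_trans[OF norm_ge_zero e1[of n]]
      by (intro mult_mono power_mono) auto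
    finally show ?thesis using False by (simp add: b_def)
  qed
  have s1: "summable (\<lambda>n. cmod (e n * z ^ n))"
    by (rule summable_comparison_test'[OF sums_summable[OF b]])
      (use order_trans[OF _ le] in \<open>simp add: norm_mult\<close>)
  have s2: "summable (\<lambda>n. cmod (of_nat n * e n * z ^ n))"
    by (rule summable_comparison_test'[OF sums_summable[OF b]])
      (use order_trans[OF _ le] in \<open>simp add: norm_mult\<close>)
  have "cmod E1 + cmod E2 \<le> (\<Sum>n. cmod (e n * z ^ n)) + (\<Sum>n. cmod (of_nat n * e n * z ^ n))"
    using summable_norm[OF s1] summable_norm[OF s2] E1 E2 by (simp add: sums_iff)
  also have "\<dots> = (\<Sum>n. cmod (e n * z ^ n) + cmod (of_nat n * e n * z ^ n))"
    by (rule suminf_add[OF s1 s2])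
  also have "\<dots> \<le> suminf b"
    using le by (intro suminf_le summable_add s1 s2 sums_summable[OF b])
  finally show ?thesis using b by (simp add: sums_iff)
qed

subsection \<open>Sections of harmonic maps in the class\<close>

text \<open>With coefficients in this form, a section of degree \<open>p\<close> differentiates to
  the truncation, at indices below \<open>p\<close>, of the series of the derivative.\<close>

lemma deriv_sum_antiderivatives:
  fixes c :: "nat \<Rightarrow> complex"
  shows "deriv (\<lambda>z. \<Sum>k<p. c k / of_nat (Suc k) * z ^ Suc k) = (\<lambda>z. \<Sum>k<p. c k * z ^ k)"
proof
  fix z :: complex
  have "((\<lambda>z. z ^ Suc k) has_field_derivative of_nat (Suc k) * z ^ k) (at z)" for k
    using DERIV_power[OF DERIV_ident, where n = "Suc k"] by (simp del: of_nat_Suc power_Suc)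
  then have "((\<lambda>z. \<Sum>k<p. c k / of_nat (Suc k) * z ^ Suc k) has_field_derivative
      (\<Sum>k<p. c k / of_nat (Suc k) * (of_nat (Suc k) * z ^ k))) (at z)"
    by (intro DERIV_sum DERIV_cmult)
  then show "deriv (\<lambda>z. \<Sum>k<p. c k / of_nat (Suc k) * z ^ Suc k) z = (\<Sum>k<p. c k * z ^ k)"
    by (simp add: DERIV_imp_deriv del: of_nat_Suc power_Suc)
qed

lemma Euler_derivative_polynomial:
  fixes c :: "nat \<Rightarrow> complex"
  shows "z * deriv (\<lambda>z. \<Sum>k<p. c k * z ^ k) z = (\<Sum>k<p. of_nat k * c k * z ^ k)"
proof -
  have "((\<lambda>z. z ^ k) has_field_derivative of_nat k * z ^ (k - Suc 0)) (at z)" for k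
    using DERIV_power[OF DERIV_ident, where n = k] by simp
  then have "((\<lambda>z. \<Sum>k<p. c k * z ^ k) has_field_derivative
      (\<Sum>k<p. c k * (of_nat k * z ^ (k - Suc 0)))) (at z)"
    by (intro DERIV_sum DERIV_cmult)
  then have "z * deriv (\<lambda>z. \<Sum>k<p. c k * z ^ k) z = (\<Sum>k<p. z * (c k * (of_nat k * z ^ (k - Suc 0))))"
    by (simp add: DERIV_imp_deriv sum_distrib_left)
  also have "\<dots> = (\<Sum>k<p. of_nat k * c k * z ^ k)"
  proof (rule sum.cong)
    show "z * (c k * (of_nat k * z ^ (k - Suc 0))) = of_nat k * c k * z ^ k" for k
      by (cases k) (simp_all add: mult_ac)
  qed simp
  finally show ?thesis .
qed

lemma tcoeff_Suc: "tcoeff F (Suc k) = (deriv ^^ k) (deriv F) 0 / fact k / of_nat (Suc k)"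
  by (simp add: tcoeff_def funpow_swap1 algebra_simps)

text \<open>The normalisation \<open>deriv h 0 = 1\<close> makes the leading \<open>z\<close> the
  term \<open>k = 0\<close>.\<close>

lemma psum_h_eq:
  assumes "p \<ge> 1" and "deriv h 0 = 1"
  shows "psum_h h p z = (\<Sum>k<p. (deriv ^^ k) (deriv h) 0 / fact k / of_nat (Suc k) * z ^ Suc k)"
proof -
  have "(\<Sum>k<p. tcoeff h (Suc k) * z ^ Suc k) = (\<Sum>k=1..p. tcoeff h k * z ^ k)"
    by (simp add: sum.atLeast1_atMost_eq)
  also have "\<dots> = psum_h h p z"
    using assms by (simp add: psum_h_def sum.atLeast_Suc_atMost tcoeff_def numeral_2_eq_2)
  finally show ?thesis by (simp only: tcoeff_Suc)
qed

text \<open>Here the added term \<open>k = 0\<close> vanishes.\<close>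

lemma psum_g_eq:
  assumes "q \<ge> 1" and "deriv g 0 = 0"
  shows "psum_g g q z = (\<Sum>k<q. (deriv ^^ k) (deriv g) 0 / fact k / of_nat (Suc k) * z ^ Suc k)"
proof -
  have "(\<Sum>k<q. tcoeff g (Suc k) * z ^ Suc k) = (\<Sum>k=1..q. tcoeff g k * z ^ k)"
    by (simp add: sum.atLeast1_atMost_eq)
  also have "\<dots> = psum_g g q z"
    using assms by (simp add: psum_g_def sum.atLeast_Suc_atMost tcoeff_def numeral_2_eq_2)
  finally show ?thesis by (simp only: tcoeff_Suc)
qed

text \<open>The bound \<open>Re (\<epsilon> * v) \<ge> - cmod v\<close> turns the harmonic condition
  into an analytic one on \<open>deriv h + \<epsilon> * deriv g\<close>, and
  \<open>Re_pos_if_Re_Euler_pos\<close> then removes the \<open>\<alpha>\<close> term.\<close>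

lemma W_H0_Re_pos:
  assumes "0 \<le> \<alpha>" "0 \<le> \<beta>" and W: "W_H0 \<alpha> \<beta> h g" and \<epsilon>: "cmod \<epsilon> = 1" and z: "z \<in> ball 0 1"
  shows "0 < Re (deriv h z + \<epsilon> * deriv g z)"
proof (rule Re_pos_if_Re_Euler_pos[OF \<open>0 \<le> \<alpha>\<close> _ _ z])
  have hol: "deriv h holomorphic_on ball 0 1" "deriv g holomorphic_on ball 0 1"
    using W by (auto simp: W_H0_def in_H0_def intro: holomorphic_deriv)
  then show "(\<lambda>z. deriv h z + \<epsilon> * deriv g z) holomorphic_on ball 0 1"
    by (intro holomorphic_on_add holomorphic_on_mult holomorphic_on_const)
  fix w :: complex assume w: "w \<in> ball 0 1"
  have "((\<lambda>z. deriv h z + \<epsilon> * deriv g z) has_field_derivative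
      deriv (deriv h) w + \<epsilon> * deriv (deriv g) w) (at w)"
    by (intro DERIV_add DERIV_cmult holomorphic_derivI[OF _ open_ball w] hol)
  then have d: "deriv (\<lambda>z. deriv h z + \<epsilon> * deriv g z) w = deriv (deriv h) w + \<epsilon> * deriv (deriv g) w"
    by (rule DERIV_imp_deriv)
  define u where "u = deriv h w + of_real \<alpha> * w * deriv (deriv h) w"
  define v where "v = deriv g w + of_real \<alpha> * w * deriv (deriv g) w"
  have "cmod v < Re u - \<beta>"
    using W w by (simp add: W_H0_def u_def v_def numeral_2_eq_2)
  moreover have "- Re (\<epsilon> * v) \<le> cmod v"
    using abs_Re_le_cmod[of "\<epsilon> * v"] \<epsilon> by (simp add: norm_mult)
  ultimately have "0 < Re u + Re (\<epsilon> * v)" using \<open>0 \<le> \<beta>\<close> by linarith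
  also have "Re u + Re (\<epsilon> * v) = Re (u + \<epsilon> * v)" by simp
  also have "u + \<epsilon> * v = deriv h w + \<epsilon> * deriv g w + of_real \<alpha> * w *
      (deriv (deriv h) w + \<epsilon> * deriv (deriv g) w)"
    by (simp add: u_def v_def algebra_simps)
  finally show "0 < Re (deriv h w + \<epsilon> * deriv g w + of_real \<alpha> * w *
      deriv (\<lambda>z. deriv h z + \<epsilon> * deriv g z) w)"
    unfolding d .
qed

text \<open>Padding with zeros lets a section be subtracted termwise from a full power
  series.\<close>

lemma polynomial_sums:
  fixes c :: "nat \<Rightarrow> complex"
  shows "(\<lambda>n. (if n < p then c n else 0) * z ^ n) sums (\<Sum>n<p. c n * z ^ n)"
proof -
  have "(\<lambda>n. if n \<in> {..<p} then c n * z ^ n else 0) sums (\<Sum>n<p. c n * z ^ n)"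
    by (rule sums_If_finite_set) simp
  moreover have "(if n \<in> {..<p} then c n * z ^ n else 0) = (if n < p then c n else 0) * z ^ n" for n
    by simp
  ultimately show ?thesis by simp
qed

theorem theorem5p1:
  fixes \<alpha> \<beta> :: real and h g :: "complex \<Rightarrow> complex" and p q :: nat
  assumes "\<alpha> \<ge> 0" and "0 \<le> \<beta>" and "\<beta> < 1"
    and "W_H0 \<alpha> \<beta> h g"
    and "p \<ge> 1" and "q \<ge> 1"
    and "(1 = p \<and> p < q) \<or> (3 \<le> p \<and> p < q) \<or> (3 \<le> q \<and> q < p)"
  shows "convex_map_on (psum_pq h g p q) (ball 0 (1/4))"
proof -
  \<comment> \<open>These are the coefficients of \<open>deriv h\<close> and \<open>deriv g\<close>,
    so degree at most \<open>p\<close> in a section corresponds to \<open>k < p\<close>.\<close>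
  define A where "A k = (deriv ^^ k) (deriv h) 0 / fact k" for k
  define B where "B k = (deriv ^^ k) (deriv g) 0 / fact k" for k
  define \<phi> where "\<phi> z = (\<Sum>k<p. A k / of_nat (Suc k) * z ^ Suc k)" for z
  define \<psi> where "\<psi> z = (\<Sum>k<q. B k / of_nat (Suc k) * z ^ Suc k)" for z
  have h1: "deriv h 0 = 1" and g0: "deriv g 0 = 0"
    and hol: "deriv h holomorphic_on ball 0 1" "deriv g holomorphic_on ball 0 1"
    using \<open>W_H0 \<alpha> \<beta> h g\<close> by (auto simp: W_H0_def in_H0_def intro: holomorphic_deriv)
  have A0: "A 0 = 1" and B0: "B 0 = 0"
    using h1 g0 by (simp_all add: A_def B_def)
  have psum: "psum_pq h g p q = (\<lambda>z. \<phi> z + cnj (\<psi> z))"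
    using psum_h_eq[OF \<open>p \<ge> 1\<close> h1] psum_g_eq[OF \<open>q \<ge> 1\<close> g0]
    by (simp add: psum_pq_def \<phi>_def \<psi>_def A_def B_def fun_eq_iff)
  have d1: "deriv \<phi> = (\<lambda>z. \<Sum>k<p. A k * z ^ k)" "deriv \<psi> = (\<lambda>z. \<Sum>k<q. B k * z ^ k)"
    unfolding \<phi>_def \<psi>_def by (rule deriv_sum_antiderivatives)+
  have d2: "z * deriv (deriv \<phi>) z = (\<Sum>k<p. of_nat k * A k * z ^ k)"
    "z * deriv (deriv \<psi>) z = (\<Sum>k<q. of_nat k * B k * z ^ k)" for z
    unfolding d1 by (rule Euler_derivative_polynomial)+
  have Re_pos: "0 < Re (deriv h z + \<epsilon> * deriv g z)" if "cmod \<epsilon> = 1" "z \<in> ball 0 1" for \<epsilon> z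
    using W_H0_Re_pos assms that by blast
  have dominated: "cmod (deriv g z) \<le> Re (deriv h z)" if "z \<in> ball 0 1" for z
  proof (cases "deriv g z = 0")
    case True then show ?thesis using Re_pos[of 1 z] that by simp
  next
    case False
    then have "0 < Re (deriv h z + (- cmod (deriv g z) / deriv g z) * deriv g z)"
      using that by (intro Re_pos) (simp add: norm_divide)
    then show ?thesis using False by simp
  qed
  have B_le: "cmod (B n) \<le> 1" for n
    using taylor_coeff_bound_dominated[OF hol zero_less_one dominated, of n] h1 by (simp add: B_def)
  have holP: "(\<lambda>z. deriv h z + \<epsilon> * deriv g z) holomorphic_on ball 0 1" for \<epsilon>
    by (intro holomorphic_on_add holomorphic_on_mult holomorphic_on_const hol)
  have coeffP: "(deriv ^^ n) (\<lambda>z. deriv h z + \<epsilon> * deriv g z) 0 / fact n = A n + \<epsilon> * B n" for n \<epsilon>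
  proof -
    have "(deriv ^^ n) (\<lambda>z. deriv h z + \<epsilon> * deriv g z) 0
        = (deriv ^^ n) (deriv h) 0 + (deriv ^^ n) (\<lambda>z. \<epsilon> * deriv g z) 0"
      by (rule higher_deriv_add[of _ "ball 0 1"]) (auto intro!: holomorphic_on_mult holomorphic_on_const hol)
    also have "(deriv ^^ n) (\<lambda>z. \<epsilon> * deriv g z) 0 = \<epsilon> * (deriv ^^ n) (deriv g) 0"
      by (rule higher_deriv_cmult[OF hol(2)]) auto
    finally show ?thesis by (simp add: A_def B_def add_divide_distrib)
  qed
  have AB_le: "cmod (A n + \<epsilon> * B n) \<le> 2" if "cmod \<epsilon> = 1" "n \<ge> 1" for n \<epsilon>
    using taylor_coeff_bound_Re_pos[OF holP[of \<epsilon>] zero_less_one \<open>n \<ge> 1\<close> less_imp_le[OF Re_pos[OF that(1)]]]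
    by (simp add: coeffP h1 g0)
  \<comment> \<open>Averaging over \<epsilon> = 1 and \<epsilon> = -1 isolates \<open>A n\<close>;
    the triangle inequality with \<open>B_le\<close> would only give 3.\<close>
  have A_le: "cmod (A n) \<le> 2" if "n \<ge> 1" for n
  proof -
    have "2 * cmod (A n) = cmod ((A n + 1 * B n) + (A n + (-1) * B n))"
      by (simp add: norm_mult flip: mult_2)
    also have "\<dots> \<le> 2 + 2"
      by (rule norm_triangle_le[OF add_mono]) (use AB_le[of 1 n] AB_le[of "-1" n] that in auto)
    finally show ?thesis by simp
  qed
  have key: "cmod (z * (deriv (deriv \<phi>) z + \<epsilon> * deriv (deriv \<psi>) z)) < Re (deriv \<phi> z + \<epsilon> * deriv \<psi> z)"
    if \<epsilon>: "cmod \<epsilon> = 1" and z: "cmod z < 1/4" for \<epsilon> z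
  proof (cases "p = 1")
    case True
    define e where "e n = (if n < q then \<epsilon> * B n else 0)" for n
    \<comment> \<open>The tail starts at index 1 because \<open>B 0 = 0\<close>, and the constant 1
      comes from \<open>B_le\<close>; \<open>deriv \<phi>\<close> is the constant 1.\<close>
    have "cmod (\<epsilon> * deriv \<psi> z) + cmod (\<epsilon> * (z * deriv (deriv \<psi>) z))
        \<le> 1 * (1 / (1 - 1/4)\<^sup>2 - (\<Sum>n<1. of_nat (Suc n) * (1/4) ^ n))"
    proof (rule power_series_tail_bound)
      show "(\<lambda>n. e n * z ^ n) sums (\<epsilon> * deriv \<psi> z)"
        using polynomial_sums[of q "\<lambda>n. \<epsilon> * B n" z]
        by (simp add: d1 e_def sum_distrib_left mult.assoc)
      show "(\<lambda>n. of_nat n * e n * z ^ n) sums (\<epsilon> * (z * deriv (deriv \<psi>) z))"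
        using polynomial_sums[of q "\<lambda>n. of_nat n * (\<epsilon> * B n)" z]
        by (simp add: d2 e_def sum_distrib_left mult_ac if_distrib cong: if_cong)
      show "cmod (e n) \<le> 1" for n
        using \<epsilon> B_le by (simp add: e_def norm_mult)
    qed (use z B0 in \<open>auto simp: e_def\<close>)
    then have "cmod (\<epsilon> * deriv \<psi> z) + cmod (\<epsilon> * (z * deriv (deriv \<psi>) z)) < 1"
      by (simp add: power2_eq_square)
    moreover have "Re (deriv \<phi> z + \<epsilon> * deriv \<psi> z) = 1 + Re (\<epsilon> * deriv \<psi> z)"
      using True A0 by (simp add: d1(1))
    moreover have "- Re (\<epsilon> * deriv \<psi> z) \<le> cmod (\<epsilon> * deriv \<psi> z)"
      using abs_Re_le_cmod[of "\<epsilon> * deriv \<psi> z"] by linarith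
    moreover have "cmod (z * (deriv (deriv \<phi>) z + \<epsilon> * deriv (deriv \<psi>) z))
        = cmod (\<epsilon> * (z * deriv (deriv \<psi>) z))"
    proof -
      have "z * deriv (deriv \<phi>) z = 0" using True by (simp only: d2(1)) simp
      then show ?thesis by (auto simp: mult.left_commute)
    qed
    ultimately show ?thesis by linarith
  next
    case False
    then have pq: "3 \<le> p" "3 \<le> q" using assms by auto
    define P where "P z = deriv h z + \<epsilon> * deriv g z" for z
    have coeff: "(deriv ^^ n) P 0 / fact n = A n + \<epsilon> * B n" for n
      unfolding P_def[abs_def] by (rule coeffP)
    have hP: "P holomorphic_on ball 0 1" unfolding P_def[abs_def] by (rule holP)
    have posP: "0 < Re (P w)" if "w \<in> ball 0 1" for w
      using Re_pos[OF \<epsilon> that] by (simp add: P_def)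
    have z1: "z \<in> ball 0 1" using z by simp
    have P35: "3/5 \<le> Re (P z)"
    proof -
      have "3/5 \<le> (1 - cmod z) / (1 + cmod z)"
        using z norm_ge_zero[of z] by (simp add: pos_le_divide_eq add_pos_nonneg)
      also have "\<dots> \<le> Re (P z)"
        using z by (intro Re_pos_lower_bound hP posP) (auto simp: P_def h1 g0)
      finally show ?thesis .
    qed
    \<comment> \<open>The coefficient bound at \<open>z\<close> instead of \<open>0\<close> plays the role of the (sharper) Schwarz-Pick estimate.\<close>
    have zP: "cmod (z * deriv P z) \<le> 2/3 * Re (P z)"
    proof -
      \<comment> \<open>The radius is 1 - 1/4; the coefficient bound gives the factor 2 / (3/4) =
        8/3, and \<open>cmod z < 1/4\<close> brings it down to 2/3.\<close>
      have sub: "ball z (3/4) \<subseteq> ball 0 1"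
        using z by (simp add: ball_subset_ball_iff)
      have "cmod ((deriv ^^ 1) P z / fact 1) * (3/4) ^ 1 \<le> 2 * Re (P z)"
        by (rule taylor_coeff_bound_Re_pos[OF holomorphic_on_subset[OF hP sub]])
          (use less_imp_le[OF posP[OF subsetD[OF sub]]] in auto)
      then have "cmod (deriv P z) \<le> 8/3 * Re (P z)" by simp
      moreover have "cmod z * cmod (deriv P z) \<le> 1/4 * cmod (deriv P z)"
        using z by (intro mult_right_mono) auto
      ultimately show ?thesis by (simp add: norm_mult)
    qed
    \<comment> \<open>Depending on which truncations keep the index, \<open>e n\<close> is 0,
      \<open>A n\<close>, \<open>\<epsilon> * B n\<close> or \<open>A n + \<epsilon> * B n\<close>.
      Each has norm at most 2, and indices below 3 always give 0.\<close>
    define e where "e n = (A n + \<epsilon> * B n) - ((if n < p then A n else 0) + \<epsilon> * (if n < q then B n else 0))" for n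
    have "cmod (P z - (deriv \<phi> z + \<epsilon> * deriv \<psi> z))
          + cmod (z * deriv P z - (z * deriv (deriv \<phi>) z + \<epsilon> * (z * deriv (deriv \<psi>) z)))
        \<le> 2 * (1 / (1 - 1/4)\<^sup>2 - (\<Sum>n<3. of_nat (Suc n) * (1/4) ^ n))"
    proof (rule power_series_tail_bound)
      have "(\<lambda>n. (A n + \<epsilon> * B n) * z ^ n - ((if n < p then A n else 0) * z ^ n + \<epsilon> * ((if n < q then B n else 0) * z ^ n)))
          sums (P z - (deriv \<phi> z + \<epsilon> * deriv \<psi> z))"
        using holomorphic_power_series[OF hP z1] unfolding d1 coeff
        by (intro sums_diff sums_add sums_mult polynomial_sums) simp
      then show "(\<lambda>n. e n * z ^ n) sums (P z - (deriv \<phi> z + \<epsilon> * deriv \<psi> z))"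
        by (simp add: e_def algebra_simps)
      have "(\<lambda>n. of_nat n * (A n + \<epsilon> * B n) * z ^ n - ((if n < p then of_nat n * A n else 0) * z ^ n
            + \<epsilon> * ((if n < q then of_nat n * B n else 0) * z ^ n)))
          sums (z * deriv P z - (z * deriv (deriv \<phi>) z + \<epsilon> * (z * deriv (deriv \<psi>) z)))"
        using Euler_derivative_sums[OF hP z1] unfolding d2 coeff
        by (intro sums_diff sums_add sums_mult polynomial_sums) simp
      moreover have "of_nat n * (A n + \<epsilon> * B n) * z ^ n - ((if n < p then of_nat n * A n else 0) * z ^ n
            + \<epsilon> * ((if n < q then of_nat n * B n else 0) * z ^ n)) = of_nat n * e n * z ^ n" for n
        by (simp add: e_def algebra_simps)
      ultimately show "(\<lambda>n. of_nat n * e n * z ^ n) sums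
          (z * deriv P z - (z * deriv (deriv \<phi>) z + \<epsilon> * (z * deriv (deriv \<psi>) z)))"
        by simp
      show "e n = 0" if "n < 3" for n using that pq by (simp add: e_def)
      show "cmod (e n) \<le> 2" for n
      proof (cases "n \<ge> 1")
        case True
        have "cmod (\<epsilon> * B n) \<le> 2" using \<epsilon> B_le[of n] by (simp add: norm_mult)
        then show ?thesis using AB_le[OF \<epsilon> True] A_le[OF True] by (simp add: e_def)
      next
        case False
        then show ?thesis using pq by (simp add: e_def)
      qed
    qed (use z in auto)
    also have "\<dots> = 13/72"
      by (simp add: numeral_3_eq_3 lessThan_Suc power2_eq_square)
    finally have tail: "cmod (P z - (deriv \<phi> z + \<epsilon> * deriv \<psi> z))
          + cmod (z * deriv P z - (z * deriv (deriv \<phi>) z + \<epsilon> * (z * deriv (deriv \<psi>) z))) \<le> 13/72" .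
    have "z * (deriv (deriv \<phi>) z + \<epsilon> * deriv (deriv \<psi>) z)
        = z * deriv (deriv \<phi>) z + \<epsilon> * (z * deriv (deriv \<psi>) z)"
      by (simp add: algebra_simps)
    then have "cmod (z * (deriv (deriv \<phi>) z + \<epsilon> * deriv (deriv \<psi>) z)) \<le> cmod (z * deriv P z)
        + cmod (z * deriv P z - (z * deriv (deriv \<phi>) z + \<epsilon> * (z * deriv (deriv \<psi>) z)))"
      by (metis norm_minus_commute norm_triangle_sub)
    moreover have "Re (P z) - Re (deriv \<phi> z + \<epsilon> * deriv \<psi> z) \<le> cmod (P z - (deriv \<phi> z + \<epsilon> * deriv \<psi> z))"
      using complex_Re_le_cmod[of "P z - (deriv \<phi> z + \<epsilon> * deriv \<psi> z)"] by simp
    \<comment> \<open>By \<open>zP\<close> and the two estimates above, it suffices that the joint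
      error is below \<open>Re (P z) / 3\<close>; this is at least 1/5 by \<open>P35\<close>, and
      13/72 < 1/5.\<close>
    ultimately show ?thesis using tail zP P35 by linarith
  qed
  show ?thesis unfolding psum
  proof (rule harmonic_convex_map)
    show "\<phi> holomorphic_on ball 0 (1/4)" "\<psi> holomorphic_on ball 0 (1/4)"
      unfolding \<phi>_def \<psi>_def by (intro holomorphic_intros; simp)+
    fix \<epsilon> z :: complex assume \<epsilon>: "cmod \<epsilon> = 1" and "z \<in> ball 0 (1/4)"
    then have *: "cmod (z * (deriv (deriv \<phi>) z + \<epsilon> * deriv (deriv \<psi>) z)) < Re (deriv \<phi> z + \<epsilon> * deriv \<psi> z)"
      by (intro key) auto
    then show pos: "0 < Re (deriv \<phi> z + \<epsilon> * deriv \<psi> z)"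
      using norm_ge_zero le_less_trans by blast
    define u where "u = deriv \<phi> z + \<epsilon> * deriv \<psi> z"
    define w where "w = z * (deriv (deriv \<phi>) z + \<epsilon> * deriv (deriv \<psi>) z)"
    \<comment> \<open>The criterion puts \<open>w / u\<close> in the closed unit disc, so
      \<open>1 + w / u\<close> has nonnegative real part.\<close>
    have "cmod w \<le> cmod u" "u \<noteq> 0"
      using * pos complex_Re_le_cmod[of u] by (auto simp: u_def w_def)
    then have "cmod (w / u) \<le> 1" by (simp add: norm_divide divide_le_eq)
    then show "0 \<le> Re (1 + z * (deriv (deriv \<phi>) z + \<epsilon> * deriv (deriv \<psi>) z) / (deriv \<phi> z + \<epsilon> * deriv \<psi> z))"
      using abs_Re_le_cmod[of "w / u"] by (simp add: u_def w_def)
  qed simp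
qed

end
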